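(* Suppose that the system $dx_t=P(x_t)\,dt+\sigma\,dB_t$, $x_0=0$, is noise propagating, and let $\tau_\infty$ be the explosion time of $x_t$. For $\epsilon>0$ let $y_{\epsilon,t}=\big(x^1_{\epsilon t}/\epsilon^{\mathfrak b_1},\dots,x^n_{\epsilon t}/\epsilon^{\mathfrak b_n}\big)$ and $B_{\epsilon,t}=B_{\epsilon t}/\sqrt\epsilon$. Then for any $t<\tau_\infty/\epsilon$ we have $$dy_{\epsilon,t}=P_{\mathrm D}(y_{\epsilon,t})\,dt+R_{\epsilon,\mathrm D}(y_{\epsilon,t})\,dt+\sigma\,dB_{\epsilon,t},\qquad y_{\epsilon,0}=0,$$ where $R_{\epsilon,\mathrm D}$ is a polynomial vector field on $\mathbf R^n$ such that $\sup_{|x|\le C}|R_{\epsilon,\mathrm D}(x)|\to0$ as $\epsilon\to0^+$ for all $C>0$.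
   Context: Setting. $n\ge1$, $I=\{1,\dots,n\}$, $P=(P^1,\dots,P^n):\mathbf R^n\to\mathbf R^n$ is a polynomial vector field, $\sigma=\mathrm{diag}(\sigma^1,\dots,\sigma^n)$ with constants $\sigma^i\ge0$ (some may vanish), $B_t$ is a standard $n$-dimensional Brownian motion on a filtered probability space, and $x_t$ is the unique pathwise solution of $dx_t=P(x_t)dt+\sigma dB_t$, $x_0=0$, defined up to $\tau_\infty=\lim_k\inf\{t\ge0:|x_t|\ge k\}$. Power scalings (the second coordinates of the paper's pair scalings are all zero here and are omitted). Work in $\tfrac12\mathbf Z_{\ge0}\cup\{\infty\}$ with the usual order, $c+\infty=\infty$, $\ell\cdot\infty=\infty$ for $\ell\ge1$, $0\cdot\infty=0$. For a monomial $m(x)=\alpha(x^1)^{n_1}\cdots(x^n)^{n_n}$, $\alpha\ne0$, put $m(c_1,\dots,c_n)=n_1c_1+\cdots+n_nc_n$; the zero polynomial has value $\infty$; a nonzero polynomial, written as a sum of a minimal number of monomials (standard form), has value the minimum of the values of its monomials. Inductive procedure. $I_0=\{j\in I:\sigma^j>0\}$; $b_{0,j}=1/2$ and $P^j_{\mathrm D}\equiv0$ for $j\in I_0$; $b_{0,j}=\infty$ for $j\notin I_0$. For $\ell\ge0$: if $I\setminus\bigcup_{k=0}^\ell I_k=\emptyset$ or $P^j(b_{\ell,1},\dots,b_{\ell,n})=\infty$ for all $j\in I\setminus\bigcup_{k=0}^\ell I_k$, stop and set $I_i=\emptyset$ for $i\ge\ell+1$. Otherwise let $m_{\ell+1}=\min\{P^j(b_{\ell,1},\dots,b_{\ell,n}):j\in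 I\setminus\bigcup_{k=0}^\ell I_k\}$, $I_{\ell+1}=\{j\in I\setminus\bigcup_{k=0}^\ell I_k:P^j(b_{\ell,1},\dots,b_{\ell,n})=m_{\ell+1}\}$; $b_{\ell+1,j}=m_{\ell+1}+1$ for $j\in I_{\ell+1}$ and $b_{\ell+1,j}=b_{\ell,j}$ otherwise; for $j\in I_{\ell+1}$ let $P^j_{\mathrm D}$ be the sum of those monomials in the standard form of $P^j$ whose value at $(b_{\ell,1},\dots,b_{\ell,n})$ equals $m_{\ell+1}$. The system is noise propagating if $\bigcup_{k=0}^\ell I_k=I$ for some $\ell\ge0$; with $\dim$ the smallest such $\ell$, $\mathfrak b_j:=b_{\dim,j}$. $P_{\mathrm D}=(P^1_{\mathrm D},\dots,P^n_{\mathrm D})$. *)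

theory Defs
  imports "HOL-Probability.Probability" "HOL-Library.Poly_Mapping"
begin

section \<open>Polynomials in the coordinates of \<open>real ^ 'n\<close>\<close>

text \<open>
  A polynomial is a finitely supported map from exponent vectors to coefficients.  Its support
  \<open>keys p\<close> lists the monomials of its standard form, each exponent vector occurring once.
\<close>

type_synonym 'n rpoly = "('n \<Rightarrow>\<^sub>0 nat) \<Rightarrow>\<^sub>0 real"

definition poly_eval :: "'n::finite rpoly \<Rightarrow> real ^ 'n \<Rightarrow> real" where
  "poly_eval p x = (\<Sum>m\<in>Poly_Mapping.keys p. Poly_Mapping.lookup p m * (\<Prod>i\<in>UNIV. (x $ i) ^ Poly_Mapping.lookup m i))"

definition poly_field :: "('n::finite \<Rightarrow> 'n rpoly) \<Rightarrow> real ^ 'n \<Rightarrow> real ^ 'n" where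
  "poly_field P x = (\<chi> i. poly_eval (P i) x)"

definition poly_restrict :: "(('n \<Rightarrow>\<^sub>0 nat) \<Rightarrow> bool) \<Rightarrow> 'n rpoly \<Rightarrow> 'n rpoly" where
  "poly_restrict Q p = (\<Sum>m\<in>{m \<in> Poly_Mapping.keys p. Q m}. Poly_Mapping.single m (Poly_Mapping.lookup p m))"


section \<open>Power scalings and the inductive procedure\<close>

text \<open>
  Scalings live in \<open>ennreal\<close>, where \<open>c + \<infinity> = \<infinity>\<close>, \<open>k * \<infinity> = \<infinity>\<close> for \<open>k \<ge> 1\<close> and \<open>0 * \<infinity> = 0\<close>.
  The procedure starts from \<open>1/2\<close> and \<open>\<infinity>\<close> and only takes sums, natural multiples and minima
  and adds \<open>1\<close>, so it stays among the nonnegative half-integers and \<open>\<infinity>\<close>.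
\<close>

definition monom_value :: "('n::finite \<Rightarrow>\<^sub>0 nat) \<Rightarrow> ('n \<Rightarrow> ennreal) \<Rightarrow> ennreal" where
  "monom_value m c = (\<Sum>i\<in>UNIV. of_nat (Poly_Mapping.lookup m i) * c i)"

definition poly_value :: "'n::finite rpoly \<Rightarrow> ('n \<Rightarrow> ennreal) \<Rightarrow> ennreal" where
  "poly_value p c = (if p = 0 then \<infinity> else Min ((\<lambda>m. monom_value m c) ` Poly_Mapping.keys p))"

definition min_value :: "('n::finite \<Rightarrow> 'n rpoly) \<Rightarrow> 'n set \<Rightarrow> ('n \<Rightarrow> ennreal) \<Rightarrow> ennreal" where
  "min_value P J c = Min ((\<lambda>j. poly_value (P j) c) ` J)"

text \<open>
  \<open>layer P s l\<close> is the set \<open>I\<^sub>l\<close> and \<open>scal P s l j\<close> is \<open>b\<^sub>l\<^sub>,\<^sub>j\<close>.  Once the stopping criterion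
  holds at some stage, all later layers are empty, the scalings no longer change, and so the
  criterion holds again at each later stage.
\<close>

function (sequential) layer :: "('n::finite \<Rightarrow> 'n rpoly) \<Rightarrow> real ^ 'n \<Rightarrow> nat \<Rightarrow> 'n set"
  and scal :: "('n \<Rightarrow> 'n rpoly) \<Rightarrow> real ^ 'n \<Rightarrow> nat \<Rightarrow> 'n \<Rightarrow> ennreal"
where
  "layer P s 0 = {j. s $ j > 0}"
| "layer P s (Suc l) =
     (let J = UNIV - (\<Union>k\<in>{..l}. layer P s k); b = scal P s l in
      if J = {} \<or> (\<forall>j\<in>J. poly_value (P j) b = \<infinity>) then {}
      else {j \<in> J. poly_value (P j) b = min_value P J b})"
| "scal P s 0 = (\<lambda>j. if s $ j > 0 then ennreal (1 / 2) else \<infinity>)"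
| "scal P s (Suc l) =
     (let J = UNIV - (\<Union>k\<in>{..l}. layer P s k); b = scal P s l; L = layer P s (Suc l) in
      (\<lambda>j. if j \<in> L then min_value P J b + 1 else b j))"
  by pat_completeness auto
termination
  by (relation "Wellfounded.measure (case_sum (\<lambda>(P, s, l). 2 * l) (\<lambda>(P, s, l). 2 * l + 1))") auto

text \<open>\<open>level_min P s l\<close> is \<open>m\<^sub>l\<^sub>+\<^sub>1\<close>; it is meaningful only if the procedure has not stopped at stage \<open>l\<close>.\<close>

definition level_min :: "('n::finite \<Rightarrow> 'n rpoly) \<Rightarrow> real ^ 'n \<Rightarrow> nat \<Rightarrow> ennreal" where
  "level_min P s l = min_value P (UNIV - (\<Union>k\<in>{..l}. layer P s k)) (scal P s l)"

definition noise_propagating :: "('n::finite \<Rightarrow> 'n rpoly) \<Rightarrow> real ^ 'n \<Rightarrow> bool" where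
  "noise_propagating P s \<longleftrightarrow> (\<exists>l. (\<Union>k\<in>{..l}. layer P s k) = UNIV)"

definition np_dim :: "('n::finite \<Rightarrow> 'n rpoly) \<Rightarrow> real ^ 'n \<Rightarrow> nat" where
  "np_dim P s = (LEAST l. (\<Union>k\<in>{..l}. layer P s k) = UNIV)"

text \<open>For a noise propagating system all \<open>scal P s (np_dim P s) j\<close> are finite, so \<open>enn2real\<close> loses nothing.\<close>

definition final_scal :: "('n::finite \<Rightarrow> 'n rpoly) \<Rightarrow> real ^ 'n \<Rightarrow> 'n \<Rightarrow> real" where
  "final_scal P s j = enn2real (scal P s (np_dim P s) j)"

text \<open>
  The layers are disjoint, so the index \<open>l\<close> with \<open>j \<in> I\<^sub>l\<^sub>+\<^sub>1\<close> is unique; it exists for every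
  \<open>j \<notin> I\<^sub>0\<close> if the system is noise propagating.
\<close>

definition dominant :: "('n::finite \<Rightarrow> 'n rpoly) \<Rightarrow> real ^ 'n \<Rightarrow> 'n \<Rightarrow> 'n rpoly" where
  "dominant P s j =
     (if j \<in> layer P s 0 then 0
      else let l = (THE l. j \<in> layer P s (Suc l)) in
        poly_restrict (\<lambda>m. monom_value m (scal P s l) = level_min P s l) (P j))"


section \<open>Stochastic differential equations with constant diffusion matrix\<close>

definition diag_matrix :: "real ^ 'n \<Rightarrow> real ^ 'n ^ 'n" where
  "diag_matrix s = (\<chi> i j. if i = j then s $ i else 0)"

text \<open>
  Time runs through the nonnegative reals.  The filtration is indexed by all reals only for the
  sake of the locale \<open>filtration\<close>; its members at negative times play no role.
\<close>

definition filtered_prob_space :: "'a measure \<Rightarrow> (real \<Rightarrow> 'a measure) \<Rightarrow> bool" where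
  "filtered_prob_space M F \<longleftrightarrow>
     prob_space M \<and> filtration (space M) F \<and> (\<forall>t. subalgebra M (F t))"

definition brownian_motion ::
  "'a measure \<Rightarrow> (real \<Rightarrow> 'a measure) \<Rightarrow> (real \<Rightarrow> 'a \<Rightarrow> real ^ 'n) \<Rightarrow> bool" where
  "brownian_motion M F B \<longleftrightarrow>
     (\<forall>t\<ge>0. B t \<in> borel_measurable (F t)) \<and>
     (AE \<omega> in M. B 0 \<omega> = 0 \<and> continuous_on {0..} (\<lambda>t. B t \<omega>)) \<and>
     (\<forall>s t. 0 \<le> s \<and> s < t \<longrightarrow>
        prob_space.indep_set M (sets (F s))
          {(\<lambda>\<omega>. B t \<omega> - B s \<omega>) -` A \<inter> space M | A. A \<in> sets borel} \<and>
        prob_space.indep_vars M (\<lambda>_. borel) (\<lambda>i \<omega>. (B t \<omega> - B s \<omega>) $ i) UNIV \<and>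
        (\<forall>i. distributed M lborel (\<lambda>\<omega>. (B t \<omega> - B s \<omega>) $ i) (normal_density 0 (sqrt (t - s)))))"

text \<open>
  \<open>solves_sde M F B f A z x T\<close>: the adapted continuous process \<open>x\<close>, with random lifetime \<open>T\<close>,
  satisfies \<open>dx\<^sub>t = f(x\<^sub>t) dt + A dB\<^sub>t\<close>, \<open>x\<^sub>0 = z\<close>, for \<open>t < T\<close>, where \<open>B\<close> is a standard Brownian
  motion on the filtered probability space \<open>(M, F)\<close>.  As \<open>A\<close> is constant, the stochastic integral
  of \<open>A\<close> over \<open>[0, t]\<close> is \<open>A (B\<^sub>t - B\<^sub>0)\<close>.  The values \<open>x t \<omega>\<close> with \<open>t \<ge> T \<omega>\<close> are irrelevant.
\<close>

definition solves_sde ::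
  "'a measure \<Rightarrow> (real \<Rightarrow> 'a measure) \<Rightarrow> (real \<Rightarrow> 'a \<Rightarrow> real ^ 'n) \<Rightarrow>
   (real ^ 'n \<Rightarrow> real ^ 'n) \<Rightarrow> real ^ 'n ^ 'n \<Rightarrow> real ^ 'n \<Rightarrow>
   (real \<Rightarrow> 'a \<Rightarrow> real ^ 'n) \<Rightarrow> ('a \<Rightarrow> ereal) \<Rightarrow> bool" where
  "solves_sde M F B f A z x T \<longleftrightarrow>
     filtered_prob_space M F \<and> brownian_motion M F B \<and>
     (\<forall>t\<ge>0. {\<omega> \<in> space M. ereal t < T \<omega>} \<in> sets (F t) \<and>
        (\<lambda>\<omega>. if ereal t < T \<omega> then x t \<omega> else 0) \<in> borel_measurable (F t)) \<and>
     (AE \<omega> in M. x 0 \<omega> = z \<and>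
        continuous_on {t. 0 \<le> t \<and> ereal t < T \<omega>} (\<lambda>t. x t \<omega>) \<and>
        (\<forall>t. 0 \<le> t \<and> ereal t < T \<omega> \<longrightarrow>
           ((\<lambda>s. f (x s \<omega>)) has_integral (x t \<omega> - x 0 \<omega> - A *v (B t \<omega> - B 0 \<omega>))) {0..t}))"

text \<open>
  \<open>T = lim\<^sub>k inf {t \<ge> 0. |x\<^sub>t| \<ge> k}\<close> for a path \<open>x\<close> living on \<open>[0, T)\<close>; the infimum of the empty
  set is \<open>\<infinity>\<close>.  In particular a bounded path living on \<open>[0, T)\<close> satisfies this only if \<open>T = \<infinity>\<close>,
  so \<open>x\<close> cannot have been stopped before it explodes.
\<close>

definition is_explosion_time :: "(real \<Rightarrow> real ^ 'n) \<Rightarrow> ereal \<Rightarrow> bool" where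
  "is_explosion_time x T \<longleftrightarrow>
     (\<lambda>k::nat. Inf {ereal t | t. 0 \<le> t \<and> ereal t < T \<and> norm (x t) \<ge> real k}) \<longlonglongrightarrow> T"

end

theory Submission
  imports Defs
begin

text \<open>
  Rescaling time by \<open>\<epsilon>\<close> and the \<open>j\<close>-th coordinate by \<open>\<epsilon>\<close> to the power \<open>- b j\<close> multiplies a monomial
  \<open>m\<close> of the \<open>j\<close>-th drift component by \<open>\<epsilon>\<close> to the power \<open>1 - b j + weight b m\<close>, where
  \<open>weight b m\<close> is the value of \<open>m\<close> at the scalings \<open>b\<close>.  Since the new drift is a sum over the same
  finitely many monomials, everything reduces to one fact about the inductive procedure: with the
  final scalings this exponent is never negative, and it vanishes exactly for the monomials kept
  in the dominant part.  The remainder then consists of the monomials carrying a positive power of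
  \<open>\<epsilon>\<close>, and it vanishes uniformly on bounded sets.

  For a coordinate driven directly by noise, \<open>b j = 1 / 2\<close>, so the exponent is at least \<open>1 / 2\<close>
  and nothing is dominant.  If \<open>j\<close> is reached at stage \<open>l + 1\<close>, then \<open>b j\<close> is the
  minimal value of that stage plus one, and the exponent is \<open>weight b m\<close> minus this minimum.  The
  selection of monomials compares the minimum with the value of \<open>m\<close> at the scalings of stage \<open>l\<close>,
  not at the final ones.  These agree if \<open>m\<close> contains only coordinates reached by stage \<open>l\<close>.
  Otherwise the value at stage \<open>l\<close> is infinite, so \<open>m\<close> is not selected, and its final value must be
  shown to exceed the minimum strictly.  This is the content of \<open>scal_new_ge\<close>: every coordinate
  reached later gets a scaling larger by at least one than the minimum of stage \<open>l\<close>.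

  The probabilistic part is a deterministic change of variables in the integral equation of each
  path, together with Brownian scaling.  The noise term keeps its coefficient because
  noisy coordinates are divided by \<open>\<epsilon>\<close> to the power \<open>1 / 2\<close>.
\<close>

section \<open>Finiteness and growth of the power scalings\<close>

definition reached :: "('n::finite \<Rightarrow> 'n rpoly) \<Rightarrow> real ^ 'n \<Rightarrow> nat \<Rightarrow> 'n set" where
  "reached P s l = (\<Union>k\<in>{..l}. layer P s k)"

lemma reached_0: "reached P s 0 = layer P s 0"
  by (simp add: reached_def)

lemma reached_Suc: "reached P s (Suc l) = reached P s l \<union> layer P s (Suc l)"
  by (auto simp: reached_def atMost_Suc)

lemma reached_mono: "l \<le> l' \<Longrightarrow> reached P s l \<subseteq> reached P s l'"
  by (force simp: reached_def)

lemma min_value_le: "j \<in> J \<Longrightarrow> min_value P J c \<le> poly_value (P j) c"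
  for P :: "'n::finite \<Rightarrow> 'n rpoly"
  by (simp add: min_value_def)

lemma poly_value_le: "m \<in> Poly_Mapping.keys p \<Longrightarrow> poly_value p c \<le> monom_value m c"
  by (auto simp: poly_value_def)

lemma le_poly_valueI:
  assumes "\<And>m. m \<in> Poly_Mapping.keys p \<Longrightarrow> a \<le> monom_value m c"
  shows "a \<le> poly_value p c"
  using assms by (auto simp: poly_value_def)

lemma layer_SucD:
  assumes "j \<in> layer P s (Suc l)"
  shows "j \<notin> reached P s l"
    and "poly_value (P j) (scal P s l) = level_min P s l"
    and "level_min P s l < \<infinity>"
proof -
  define J where "J = UNIV - reached P s l"
  have stop: "\<not> (J = {} \<or> (\<forall>j\<in>J. poly_value (P j) (scal P s l) = \<infinity>))"
    and j: "j \<in> {j \<in> J. poly_value (P j) (scal P s l) = min_value P J (scal P s l)}"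
    using assms by (auto simp: Let_def J_def reached_def split: if_splits)
  show "j \<notin> reached P s l" "poly_value (P j) (scal P s l) = level_min P s l"
    using j by (auto simp: J_def level_min_def reached_def)
  obtain i where "i \<in> J" "poly_value (P i) (scal P s l) \<noteq> \<infinity>"
    using stop by auto
  then show "level_min P s l < \<infinity>"
    using min_value_le[of i J P "scal P s l"]
    by (auto simp: level_min_def J_def reached_def less_top top_unique)
qed

lemma scal_Suc:
  "scal P s (Suc l) j = (if j \<in> layer P s (Suc l) then level_min P s l + 1 else scal P s l j)"
  by (simp add: Let_def level_min_def del: layer.simps)

declare layer.simps [simp del] scal.simps [simp del]

lemma scal_finite_iff: "scal P s l j < \<infinity> \<longleftrightarrow> j \<in> reached P s l"
proof (induction l)
  case 0
  have "ennreal (1 / 2) < \<top>" by (rule ennreal_less_top)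
  then show ?case by (auto simp: scal.simps layer.simps reached_0 simp del: ennreal_half)
next
  case (Suc l)
  then show ?case
    using layer_SucD(3)[of j P s l] by (auto simp: scal_Suc reached_Suc)
qed

lemma scal_stable:
  assumes "l \<le> l'" "j \<in> reached P s l"
  shows "scal P s l' j = scal P s l j"
  using assms
proof (induction l' rule: dec_induct)
  case (step l')
  then have "j \<in> reached P s l'"
    using reached_mono[of l l'] by auto
  then show ?case
    using step layer_SucD(1)[of j P s l'] by (auto simp: scal_Suc)
qed simp

lemma level_min_le_monom_value:
  assumes "j \<notin> reached P s l" "m \<in> Poly_Mapping.keys (P j)"
  shows "level_min P s l \<le> monom_value m (scal P s l)"
  using min_value_le[of j "UNIV - reached P s l" P "scal P s l"] poly_value_le[OF assms(2)] assms(1)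
  by (force simp: level_min_def reached_def intro: order_trans)

lemma monom_value_factor_le:
  fixes m :: "'n::finite \<Rightarrow>\<^sub>0 nat"
  assumes "Poly_Mapping.lookup m k > 0"
  shows "c k \<le> monom_value m c"
proof -
  have "1 * c k \<le> of_nat (Poly_Mapping.lookup m k) * c k"
    using assms by (intro mult_right_mono) (auto simp: Suc_le_eq)
  also have "\<dots> \<le> monom_value m c"
    unfolding monom_value_def by (rule member_le_sum) auto
  finally show ?thesis by simp
qed

text \<open>
  A monomial in coordinates that already have a finite scaling keeps its value for ever.  Any other
  monomial has infinite value at stage \<open>l\<close>, and its later values are bounded below by the scaling of
  one of its new coordinates.
\<close>

lemma monom_value_stable_or_new:
  assumes "l \<le> l'"
  shows "monom_value m (scal P s l') = monom_value m (scal P s l) \<or>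
    (\<exists>k. k \<notin> reached P s l \<and> monom_value m (scal P s l) = \<infinity> \<and>
       scal P s l' k \<le> monom_value m (scal P s l'))"
proof (cases "\<exists>k. k \<notin> reached P s l \<and> Poly_Mapping.lookup m k > 0")
  case True
  then obtain k where k: "k \<notin> reached P s l" "Poly_Mapping.lookup m k > 0" by blast
  have "scal P s l k = \<infinity>"
    using scal_finite_iff[of P s l k] k(1) by (simp flip: less_top)
  then have "monom_value m (scal P s l) = \<infinity>"
    using monom_value_factor_le[OF k(2), of "scal P s l"] by (simp add: top_unique)
  then show ?thesis
    using k monom_value_factor_le[OF k(2), of "scal P s l'"] by auto
next
  case False
  then have "monom_value m (scal P s l') = monom_value m (scal P s l)"
    unfolding monom_value_def
  proof (intro sum.cong refl)
    fix i
    show "of_nat (Poly_Mapping.lookup m i) * scal P s l' i =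
      of_nat (Poly_Mapping.lookup m i) * scal P s l i"
    proof (cases "Poly_Mapping.lookup m i = 0")
      case nonzero: False
      then have "i \<in> reached P s l" using False by blast
      then show ?thesis by (simp add: scal_stable[OF assms])
    qed simp
  qed
  then show ?thesis by blast
qed

text \<open>
  A scaling assigned after stage \<open>l\<close> is one plus the value of some drift component, so it suffices
  to bound the values of its monomials below by the minimum of stage \<open>l\<close>.  That component already
  competed at stage \<open>l\<close>, which settles monomials whose value has not changed since.  A monomial
  whose value has changed contains a coordinate assigned in the meantime, to which the induction
  hypothesis applies.
\<close>

lemma scal_new_ge:
  assumes "l \<le> l'" "k \<notin> reached P s l"
  shows "level_min P s l + 1 \<le> scal P s l' k"
  using assms
proof (induction l' arbitrary: k rule: dec_induct)
  case base
  then have "scal P s l k = \<infinity>"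
    using scal_finite_iff[of P s l k] by (simp flip: less_top)
  then show ?case by simp
next
  case (step l')
  show ?case
  proof (cases "k \<in> layer P s (Suc l')")
    case True
    have "level_min P s l \<le> poly_value (P k) (scal P s l')"
    proof (rule le_poly_valueI)
      fix m assume m: "m \<in> Poly_Mapping.keys (P k)"
      show "level_min P s l \<le> monom_value m (scal P s l')"
        using monom_value_stable_or_new[OF step.hyps(1), of m P s]
      proof (elim disjE exE conjE)
        assume "monom_value m (scal P s l') = monom_value m (scal P s l)"
        then show ?thesis
          using level_min_le_monom_value[OF step.prems m] by simp
      next
        fix k' assume "k' \<notin> reached P s l"
          and le: "scal P s l' k' \<le> monom_value m (scal P s l')"
        have "level_min P s l \<le> level_min P s l + 1" by simp
        also have "\<dots> \<le> scal P s l' k'" by (rule step.IH) fact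
        finally show ?thesis using le by simp
      qed
    qed
    then show ?thesis
      using True layer_SucD(2)[OF True] by (simp add: scal_Suc add_right_mono)
  next
    case False
    then show ?thesis using step by (simp add: scal_Suc)
  qed
qed

text \<open>
  The monomials attaining the minimum can be recognised at any later stage: a value that was infinite
  when the minimum was taken may become finite, but it stays above the minimum by at least one.
\<close>

lemma monom_value_eq_level_min_iff:
  assumes j: "j \<in> layer P s (Suc l)" and m: "m \<in> Poly_Mapping.keys (P j)" and "l \<le> l'"
  shows "level_min P s l \<le> monom_value m (scal P s l')"
    and "monom_value m (scal P s l') = level_min P s l \<longleftrightarrow>
         monom_value m (scal P s l) = level_min P s l"
proof -
  note fin = layer_SucD(3)[OF j]
  have "(monom_value m (scal P s l') = monom_value m (scal P s l)) \<or>
    (monom_value m (scal P s l) = \<infinity> \<and> level_min P s l < monom_value m (scal P s l'))"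
    using monom_value_stable_or_new[OF \<open>l \<le> l'\<close>, of m P s]
  proof (elim disjE exE conjE)
    fix k assume k: "k \<notin> reached P s l" "monom_value m (scal P s l) = \<infinity>"
      "scal P s l' k \<le> monom_value m (scal P s l')"
    have "level_min P s l < level_min P s l + 1"
      using fin by (cases "level_min P s l") (auto simp: ennreal_less_iff simp flip: ennreal_plus ennreal_1)
    also have "\<dots> \<le> scal P s l' k" by (rule scal_new_ge) fact+
    finally show ?thesis using k by auto
  qed simp
  moreover have "level_min P s l \<le> monom_value m (scal P s l)"
    using level_min_le_monom_value[OF layer_SucD(1)[OF j] m] .
  ultimately show "level_min P s l \<le> monom_value m (scal P s l')"
    "monom_value m (scal P s l') = level_min P s l \<longleftrightarrow>
         monom_value m (scal P s l) = level_min P s l"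
    using fin by auto
qed


section \<open>The exponent of \<open>\<epsilon>\<close> carried by a monomial of the rescaled drift\<close>

definition weight :: "('n::finite \<Rightarrow> real) \<Rightarrow> ('n \<Rightarrow>\<^sub>0 nat) \<Rightarrow> real" where
  "weight b m = (\<Sum>i\<in>UNIV. real (Poly_Mapping.lookup m i) * b i)"

definition drift_exponent :: "('n::finite \<Rightarrow> real) \<Rightarrow> 'n \<Rightarrow> ('n \<Rightarrow>\<^sub>0 nat) \<Rightarrow> real" where
  "drift_exponent b j m = 1 - b j + weight b m"

lemma reached_np_dim:
  assumes "noise_propagating P s"
  shows "reached P s (np_dim P s) = UNIV"
  using assms unfolding noise_propagating_def np_dim_def reached_def by (rule LeastI_ex)

lemma scal_np_dim:
  assumes "noise_propagating P s"
  shows "scal P s (np_dim P s) j = ennreal (final_scal P s j)"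
  using scal_finite_iff[of P s "np_dim P s" j] reached_np_dim[OF assms]
  by (simp add: final_scal_def)

lemma final_scal_nonneg: "final_scal P s j \<ge> 0"
  by (simp add: final_scal_def)

lemma final_scal_noisy:
  assumes "noise_propagating P s" "s $ j > 0"
  shows "final_scal P s j = 1 / 2"
proof -
  have "j \<in> reached P s 0" using assms(2) by (simp add: reached_0 layer.simps)
  then have "scal P s (np_dim P s) j = ennreal (1 / 2)"
    using scal_stable[of 0 "np_dim P s" j P s] assms(2) by (simp add: scal.simps)
  then have "final_scal P s j = enn2real (ennreal (1 / 2))" by (simp only: final_scal_def)
  then show ?thesis by (subst (asm) enn2real_ennreal) auto
qed

lemma monom_value_np_dim:
  assumes "noise_propagating P s"
  shows "monom_value m (scal P s (np_dim P s)) = ennreal (weight (final_scal P s) m)"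
  unfolding monom_value_def weight_def scal_np_dim[OF assms]
  by (simp add: final_scal_nonneg ennreal_mult' ennreal_of_nat_eq_real_of_nat flip: sum_ennreal)

lemma weight_nonneg: "weight (final_scal P s) m \<ge> 0"
  unfolding weight_def by (intro sum_nonneg mult_nonneg_nonneg final_scal_nonneg) simp

lemma layer_Suc_unique:
  assumes "j \<in> layer P s (Suc l)" "j \<in> layer P s (Suc l')"
  shows "l = l'"
proof -
  have "\<not> a < b" if "j \<in> layer P s (Suc a)" "j \<in> layer P s (Suc b)" for a b
    using that layer_SucD(1)[OF that(2)] reached_mono[of "Suc a" b P s]
    by (auto simp: reached_Suc)
  then show ?thesis using assms by (meson linorder_neqE_nat)
qed

text \<open>
  This translates the selection made stage by stage into a condition on the final scalings alone, so
  that the analysis of the rescaled drift no longer depends on the stage at which a coordinate was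
  reached.
\<close>

lemma dominant_iff_drift_exponent_0:
  assumes np: "noise_propagating P s"
  shows "dominant P s j = poly_restrict (\<lambda>m. drift_exponent (final_scal P s) j m = 0) (P j)"
    and "m \<in> Poly_Mapping.keys (P j) \<Longrightarrow> drift_exponent (final_scal P s) j m \<ge> 0"
proof -
  let ?b = "final_scal P s" and ?D = "np_dim P s"
  have "dominant P s j = poly_restrict (\<lambda>m. drift_exponent ?b j m = 0) (P j) \<and>
    (\<forall>m \<in> Poly_Mapping.keys (P j). drift_exponent ?b j m \<ge> 0)"
  proof (cases "j \<in> layer P s 0")
    case True
    then have "?b j = 1 / 2"
      using final_scal_noisy[OF np] by (simp add: layer.simps)
    then have "drift_exponent ?b j m > 0" for m
      using weight_nonneg[of P s m] by (simp add: drift_exponent_def)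
    then show ?thesis
      using True by (auto simp: dominant_def poly_restrict_def less_imp_le less_imp_neq[symmetric])
  next
    case False
    have "j \<in> reached P s ?D" using reached_np_dim[OF np] by simp
    then obtain k where "k \<le> ?D" "j \<in> layer P s k" by (auto simp: reached_def)
    then obtain l where l: "Suc l \<le> ?D" "j \<in> layer P s (Suc l)"
      using False by (cases k) auto
    have the: "(THE l. j \<in> layer P s (Suc l)) = l"
      using l(2) layer_Suc_unique by blast
    \<comment> \<open>The finite minimum of the stage that reaches \<open>j\<close>, as a real number.\<close>
    define \<mu> where "\<mu> = enn2real (level_min P s l)"
    have \<mu>: "level_min P s l = ennreal \<mu>" "\<mu> \<ge> 0"
      using layer_SucD(3)[OF l(2)] by (auto simp: \<mu>_def)
    have "ennreal (?b j) = scal P s (Suc l) j"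
      using scal_stable[OF l(1), of j P s] l(2) by (simp add: scal_np_dim[OF np] reached_Suc)
    also have "\<dots> = ennreal (\<mu> + 1)"
      using l(2) \<mu> by (simp add: scal_Suc ennreal_plus)
    finally have b: "?b j = \<mu> + 1"
      using \<mu>(2) final_scal_nonneg[of P s j] by (subst (asm) ennreal_inj) auto
    have *: "drift_exponent ?b j m \<ge> 0 \<and>
        (monom_value m (scal P s l) = level_min P s l \<longleftrightarrow> drift_exponent ?b j m = 0)"
      if m: "m \<in> Poly_Mapping.keys (P j)" for m
      using monom_value_eq_level_min_iff[OF l(2) m, of ?D] l(1) \<mu>(2) weight_nonneg[of P s m]
      by (auto simp: monom_value_np_dim[OF np] \<mu>(1) ennreal_le_iff ennreal_inj drift_exponent_def b)
    then have "{m \<in> Poly_Mapping.keys (P j). monom_value m (scal P s l) = level_min P s l} =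
      {m \<in> Poly_Mapping.keys (P j). drift_exponent ?b j m = 0}" by blast
    then show ?thesis
      using False * by (simp add: dominant_def the poly_restrict_def)
  qed
  then show "dominant P s j = poly_restrict (\<lambda>m. drift_exponent ?b j m = 0) (P j)"
    "m \<in> Poly_Mapping.keys (P j) \<Longrightarrow> drift_exponent ?b j m \<ge> 0"
    by auto
qed


section \<open>The rescaled drift and its remainder\<close>

lemma poly_eval_sum_single:
  fixes x :: "real ^ 'n::finite"
  assumes "finite S"
  shows "poly_eval (\<Sum>m\<in>S. Poly_Mapping.single m (c m)) x =
    (\<Sum>m\<in>S. c m * (\<Prod>i\<in>UNIV. (x $ i) ^ Poly_Mapping.lookup m i))"
proof -
  let ?p = "\<Sum>m\<in>S. Poly_Mapping.single m (c m)"
  have lookup: "Poly_Mapping.lookup ?p m = (if m \<in> S then c m else 0)" for m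
    using assms by (simp add: lookup_sum lookup_single when_def sum.delta)
  have "Poly_Mapping.keys ?p \<subseteq> S"
    by (auto simp: in_keys_iff lookup split: if_splits)
  then have "poly_eval ?p x =
    (\<Sum>m\<in>S. Poly_Mapping.lookup ?p m * (\<Prod>i\<in>UNIV. (x $ i) ^ Poly_Mapping.lookup m i))"
    unfolding poly_eval_def
    by (intro sum.mono_neutral_left assms) (auto simp: in_keys_iff)
  also have "\<dots> = (\<Sum>m\<in>S. c m * (\<Prod>i\<in>UNIV. (x $ i) ^ Poly_Mapping.lookup m i))"
    by (intro sum.cong) (auto simp: lookup)
  finally show ?thesis .
qed

text \<open>
  For \<open>\<epsilon> > 0\<close> and the final scalings of a noise propagating system, this is the rescaled drift
  minus the dominant part, written monomial by monomial
  so that the positive power of \<open>\<epsilon>\<close> in front of each coefficient is visible.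
\<close>

definition scaled_remainder ::
  "('n::finite \<Rightarrow> real) \<Rightarrow> ('n \<Rightarrow> 'n rpoly) \<Rightarrow> real \<Rightarrow> 'n \<Rightarrow> 'n rpoly" where
  "scaled_remainder b P \<epsilon> j =
    (\<Sum>m\<in>{m \<in> Poly_Mapping.keys (P j). drift_exponent b j m \<noteq> 0}.
       Poly_Mapping.single m (\<epsilon> powr drift_exponent b j m * Poly_Mapping.lookup (P j) m))"

lemma monom_dilate:
  fixes x :: "real ^ 'n::finite"
  assumes "\<epsilon> > 0"
  shows "(\<Prod>i\<in>UNIV. (x $ i) ^ Poly_Mapping.lookup m i) =
    \<epsilon> powr weight b m * (\<Prod>i\<in>UNIV. (x $ i / \<epsilon> powr b i) ^ Poly_Mapping.lookup m i)"
proof -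
  have "\<epsilon> powr weight b m = (\<Prod>i\<in>UNIV. (\<epsilon> powr b i) ^ Poly_Mapping.lookup m i)"
    using assms
    by (simp add: weight_def powr_sum powr_powr[symmetric] powr_realpow mult.commute)
  then show ?thesis
    using assms by (simp add: power_divide flip: prod.distrib)
qed

lemma rescaled_drift:
  fixes x :: "real ^ 'n::finite"
  assumes np: "noise_propagating P s" and "\<epsilon> > 0"
  defines "b \<equiv> final_scal P s"
  defines "y \<equiv> (\<chi> i. x $ i / \<epsilon> powr b i)"
  shows "\<epsilon> * poly_eval (P j) x / \<epsilon> powr b j =
    poly_eval (dominant P s j) y + poly_eval (scaled_remainder b P \<epsilon> j) y"
proof -
  let ?K = "Poly_Mapping.keys (P j)" and ?e = "drift_exponent b j"
  let ?mon = "\<lambda>m. \<Prod>i\<in>UNIV. (y $ i) ^ Poly_Mapping.lookup m i"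
  let ?f = "\<lambda>m. \<epsilon> powr ?e m * Poly_Mapping.lookup (P j) m * ?mon m"
  have "\<epsilon> * poly_eval (P j) x / \<epsilon> powr b j = (\<Sum>m\<in>?K. ?f m)"
    unfolding poly_eval_def sum_distrib_left sum_divide_distrib
    using \<open>\<epsilon> > 0\<close>
    by (intro sum.cong refl)
       (simp add: monom_dilate[of \<epsilon> x _ b] drift_exponent_def powr_add powr_diff y_def)
  also have "\<dots> = (\<Sum>m\<in>{m\<in>?K. ?e m = 0}. ?f m) + (\<Sum>m\<in>{m\<in>?K. ?e m \<noteq> 0}. ?f m)"
    by (subst sum.union_disjoint[symmetric]) (auto intro!: sum.cong)
  also have "(\<Sum>m\<in>{m\<in>?K. ?e m = 0}. ?f m) = poly_eval (dominant P s j) y"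
    unfolding dominant_iff_drift_exponent_0(1)[OF np] poly_restrict_def b_def[symmetric]
    using \<open>\<epsilon> > 0\<close> by (subst poly_eval_sum_single) auto
  also have "(\<Sum>m\<in>{m\<in>?K. ?e m \<noteq> 0}. ?f m) = poly_eval (scaled_remainder b P \<epsilon> j) y"
    unfolding scaled_remainder_def by (subst poly_eval_sum_single) auto
  finally show ?thesis .
qed

text \<open>
  On the ball of radius \<open>C\<close> every coordinate is at most \<open>C\<close> in modulus, so the supremum is at most
  a finite sum of constants times positive powers of \<open>\<epsilon>\<close>.
\<close>

lemma scaled_remainder_tendsto_0:
  fixes P :: "'n::finite \<Rightarrow> 'n rpoly"
  assumes nonneg: "\<And>j m. m \<in> Poly_Mapping.keys (P j) \<Longrightarrow> drift_exponent b j m \<ge> 0" and "C > 0"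
  shows "((\<lambda>\<epsilon>. SUP z\<in>cball 0 C. norm (poly_field (scaled_remainder b P \<epsilon>) z)) \<longlongrightarrow> 0) (at_right 0)"
proof -
  let ?S = "\<lambda>j. {m \<in> Poly_Mapping.keys (P j). drift_exponent b j m \<noteq> 0}"
  define g where "g \<epsilon> = (\<Sum>j\<in>UNIV. \<Sum>m\<in>?S j. \<epsilon> powr drift_exponent b j m *
    \<bar>Poly_Mapping.lookup (P j) m\<bar> * (\<Prod>i\<in>UNIV. C ^ Poly_Mapping.lookup m i))" for \<epsilon>
  have bound: "norm (poly_field (scaled_remainder b P \<epsilon>) z) \<le> g \<epsilon>" if "z \<in> cball 0 C" for z \<epsilon>
  proof -
    have z: "\<bar>z $ i\<bar> \<le> C" for i
      using that component_le_norm_cart[of z i] by simp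
    have "norm (poly_field (scaled_remainder b P \<epsilon>) z) \<le>
      (\<Sum>j\<in>UNIV. \<bar>poly_field (scaled_remainder b P \<epsilon>) z $ j\<bar>)"
      by (rule norm_le_l1_cart)
    also have "\<dots> \<le> g \<epsilon>"
      unfolding g_def
    proof (rule sum_mono)
      fix j :: 'n
      have "poly_field (scaled_remainder b P \<epsilon>) z $ j =
        (\<Sum>m\<in>?S j. \<epsilon> powr drift_exponent b j m * Poly_Mapping.lookup (P j) m *
          (\<Prod>i\<in>UNIV. (z $ i) ^ Poly_Mapping.lookup m i))"
        by (simp add: poly_field_def scaled_remainder_def poly_eval_sum_single)
      also have "\<bar>\<dots>\<bar> \<le> (\<Sum>m\<in>?S j. \<bar>\<epsilon> powr drift_exponent b j m * Poly_Mapping.lookup (P j) m *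
          (\<Prod>i\<in>UNIV. (z $ i) ^ Poly_Mapping.lookup m i)\<bar>)"
        by (rule sum_abs)
      also have "\<dots> \<le> (\<Sum>m\<in>?S j. \<epsilon> powr drift_exponent b j m *
        \<bar>Poly_Mapping.lookup (P j) m\<bar> * (\<Prod>i\<in>UNIV. C ^ Poly_Mapping.lookup m i))"
        unfolding abs_mult abs_prod power_abs
        by (intro sum_mono mult_mono prod_mono conjI power_mono z) (auto intro!: prod_nonneg)
      finally show "\<bar>poly_field (scaled_remainder b P \<epsilon>) z $ j\<bar> \<le>
        (\<Sum>m\<in>?S j. \<epsilon> powr drift_exponent b j m *
        \<bar>Poly_Mapping.lookup (P j) m\<bar> * (\<Prod>i\<in>UNIV. C ^ Poly_Mapping.lookup m i))" .
    qed
    finally show ?thesis .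
  qed
  have lim: "(g \<longlongrightarrow> 0) (at_right 0)"
    unfolding g_def
  proof (intro tendsto_null_sum)
    fix j m assume "m \<in> ?S j"
    then have "drift_exponent b j m > 0" using nonneg[of m j] by auto
    then have "((\<lambda>\<epsilon>. \<epsilon> powr drift_exponent b j m) \<longlongrightarrow> 0) (at_right 0)"
      by (intro tendsto_eq_intros) (auto simp: eventually_at_right_less intro: eventually_mono[OF eventually_at_right_less])
    then show "((\<lambda>\<epsilon>. \<epsilon> powr drift_exponent b j m * \<bar>Poly_Mapping.lookup (P j) m\<bar> *
      (\<Prod>i\<in>UNIV. C ^ Poly_Mapping.lookup m i)) \<longlongrightarrow> 0) (at_right 0)"
      by (intro tendsto_mult_left_zero)
  qed
  have ne: "(0 :: real ^ 'n) \<in> cball 0 C" using \<open>C > 0\<close> by simp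
  show ?thesis
  proof (rule tendsto_sandwich[OF _ _ tendsto_const lim])
    show "\<forall>\<^sub>F \<epsilon> in at_right 0. 0 \<le> (SUP z\<in>cball 0 C. norm (poly_field (scaled_remainder b P \<epsilon>) z))"
      by (intro always_eventually allI cSUP_upper2[OF _ ne]) (auto intro!: bdd_aboveI2 bound)
    show "\<forall>\<^sub>F \<epsilon> in at_right 0. (SUP z\<in>cball 0 C. norm (poly_field (scaled_remainder b P \<epsilon>) z)) \<le> g \<epsilon>"
      using ne by (intro always_eventually allI cSUP_least bound) auto
  qed
qed


section \<open>Invariance under change of time scale\<close>

lemma filtered_prob_space_rescale:
  assumes "filtered_prob_space M F" "\<epsilon> > 0"
  shows "filtered_prob_space M (\<lambda>t. F (\<epsilon> * t))"
  using assms unfolding filtered_prob_space_def filtration_def by simp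

lemma brownian_motion_rescale:
  fixes B :: "real \<Rightarrow> 'a \<Rightarrow> real ^ 'n::finite"
  assumes "prob_space M" and bm: "brownian_motion M F B" and \<epsilon>: "\<epsilon> > 0"
  shows "brownian_motion M (\<lambda>t. F (\<epsilon> * t)) (\<lambda>t \<omega>. B (\<epsilon> * t) \<omega> /\<^sub>R sqrt \<epsilon>)"
  unfolding brownian_motion_def
proof (intro conjI allI impI)
  interpret prob_space M by fact
  show "(\<lambda>\<omega>. B (\<epsilon> * t) \<omega> /\<^sub>R sqrt \<epsilon>) \<in> borel_measurable (F (\<epsilon> * t))" if "0 \<le> t" for t
  proof -
    have "B (\<epsilon> * t) \<in> borel_measurable (F (\<epsilon> * t))"
      using bm that \<epsilon> by (simp add: brownian_motion_def)
    then show ?thesis by measurable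
  qed
  have "AE \<omega> in M. B 0 \<omega> = 0 \<and> continuous_on {0..} (\<lambda>t. B t \<omega>)"
    using bm by (simp add: brownian_motion_def)
  then show "AE \<omega> in M. B (\<epsilon> * 0) \<omega> /\<^sub>R sqrt \<epsilon> = 0 \<and>
      continuous_on {0..} (\<lambda>t. B (\<epsilon> * t) \<omega> /\<^sub>R sqrt \<epsilon>)"
  proof eventually_elim
    case (elim \<omega>)
    have "continuous_on {0..} (\<lambda>t. B (\<epsilon> * t) \<omega>)"
      using elim \<epsilon> by (intro continuous_on_compose2[of "{0..}" "\<lambda>t. B t \<omega>" "{0..}" "(*) \<epsilon>"] continuous_intros) auto
    then show ?case using elim by (auto intro!: continuous_intros)
  qed
next
  interpret prob_space M by fact
  fix s t :: real assume st: "0 \<le> s \<and> s < t"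
  then have "0 \<le> \<epsilon> * s \<and> \<epsilon> * s < \<epsilon> * t" using \<epsilon> by simp
  with bm have
    ind: "indep_set (sets (F (\<epsilon> * s)))
      {(\<lambda>\<omega>. B (\<epsilon> * t) \<omega> - B (\<epsilon> * s) \<omega>) -` A \<inter> space M | A. A \<in> sets borel}" and
    vars: "indep_vars (\<lambda>_. borel) (\<lambda>i \<omega>. (B (\<epsilon> * t) \<omega> - B (\<epsilon> * s) \<omega>) $ i) UNIV" and
    dist: "\<And>i. distributed M lborel (\<lambda>\<omega>. (B (\<epsilon> * t) \<omega> - B (\<epsilon> * s) \<omega>) $ i)
      (normal_density 0 (sqrt (\<epsilon> * t - \<epsilon> * s)))"
    unfolding brownian_motion_def by blast+
  have incr: "B (\<epsilon> * t) \<omega> /\<^sub>R sqrt \<epsilon> - B (\<epsilon> * s) \<omega> /\<^sub>R sqrt \<epsilon> =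
    (B (\<epsilon> * t) \<omega> - B (\<epsilon> * s) \<omega>) /\<^sub>R sqrt \<epsilon>" for \<omega>
    by (simp add: scaleR_diff_right)
  \<comment> \<open>Scaling is Borel, so the rescaled increment generates no new events, and independence of the past is inherited.\<close>
  have "{(\<lambda>\<omega>. B (\<epsilon> * t) \<omega> /\<^sub>R sqrt \<epsilon> - B (\<epsilon> * s) \<omega> /\<^sub>R sqrt \<epsilon>) -` A \<inter> space M | A. A \<in> sets borel} \<subseteq>
    {(\<lambda>\<omega>. B (\<epsilon> * t) \<omega> - B (\<epsilon> * s) \<omega>) -` A \<inter> space M | A. A \<in> sets borel}"
  proof safe
    fix A :: "(real ^ 'n) set" assume A: "A \<in> sets borel"
    have "(\<lambda>v :: real ^ 'n. v /\<^sub>R sqrt \<epsilon>) \<in> borel_measurable borel"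
      by measurable
    from measurable_sets[OF this A]
    have "(\<lambda>v :: real ^ 'n. v /\<^sub>R sqrt \<epsilon>) -` A \<in> sets borel"
      by simp
    then show "\<exists>A'. (\<lambda>\<omega>. B (\<epsilon> * t) \<omega> /\<^sub>R sqrt \<epsilon> - B (\<epsilon> * s) \<omega> /\<^sub>R sqrt \<epsilon>) -` A \<inter> space M =
      (\<lambda>\<omega>. B (\<epsilon> * t) \<omega> - B (\<epsilon> * s) \<omega>) -` A' \<inter> space M \<and> A' \<in> sets borel"
      by (intro exI[of _ "(\<lambda>v :: real ^ 'n. v /\<^sub>R sqrt \<epsilon>) -` A"]) (auto simp: incr)
  qed
  then show "indep_set (sets (F (\<epsilon> * s)))
      {(\<lambda>\<omega>. B (\<epsilon> * t) \<omega> /\<^sub>R sqrt \<epsilon> - B (\<epsilon> * s) \<omega> /\<^sub>R sqrt \<epsilon>) -` A \<inter> space M | A. A \<in> sets borel}"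
    unfolding indep_set_def
    by (intro indep_sets_mono_sets[OF ind[unfolded indep_set_def]]) (auto split: bool.split)
  have "indep_vars (\<lambda>_. borel) (\<lambda>i \<omega>. (\<lambda>v. inverse (sqrt \<epsilon>) * v) ((B (\<epsilon> * t) \<omega> - B (\<epsilon> * s) \<omega>) $ i)) UNIV"
    by (rule indep_vars_compose2[OF vars]) simp
  then show "indep_vars (\<lambda>_. borel)
      (\<lambda>i \<omega>. (B (\<epsilon> * t) \<omega> /\<^sub>R sqrt \<epsilon> - B (\<epsilon> * s) \<omega> /\<^sub>R sqrt \<epsilon>) $ i) UNIV"
    by (simp add: incr)
  fix i
  have "distributed M lborel (\<lambda>\<omega>. 0 + inverse (sqrt \<epsilon>) * (B (\<epsilon> * t) \<omega> - B (\<epsilon> * s) \<omega>) $ i)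
      (normal_density (0 + inverse (sqrt \<epsilon>) * 0) (\<bar>inverse (sqrt \<epsilon>)\<bar> * sqrt (\<epsilon> * t - \<epsilon> * s)))"
    using st \<epsilon> by (intro normal_density_affine dist) auto
  moreover have "\<bar>inverse (sqrt \<epsilon>)\<bar> * sqrt (\<epsilon> * t - \<epsilon> * s) = sqrt (t - s)"
    using \<epsilon> by (simp add: real_sqrt_mult flip: right_diff_distrib)
  ultimately show "distributed M lborel
      (\<lambda>\<omega>. (B (\<epsilon> * t) \<omega> /\<^sub>R sqrt \<epsilon> - B (\<epsilon> * s) \<omega> /\<^sub>R sqrt \<epsilon>) $ i) (normal_density 0 (sqrt (t - s)))"
    by (simp add: incr)
qed

lemma has_integral_time_scale:
  fixes f :: "real \<Rightarrow> 'b::banach"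
  assumes "(f has_integral I) {0..\<epsilon> * t}" "\<epsilon> > 0"
  shows "((\<lambda>s. f (\<epsilon> * s)) has_integral (I /\<^sub>R \<epsilon>)) {0..t}"
proof -
  have cancel: "inverse \<epsilon> * (\<epsilon> * t) = t" using assms(2) by (simp add: field_simps)
  show ?thesis
    using has_integral_affinity'[of f I 0 "\<epsilon> * t" \<epsilon> 0] assms by (simp add: cancel)
qed

lemma ereal_less_divide_pos_iff:
  assumes "\<epsilon> > 0"
  shows "ereal t < T / ereal \<epsilon> \<longleftrightarrow> ereal (\<epsilon> * t) < T"
  using assms by (cases T) (auto simp: field_simps)

text \<open>
  With constant diffusion the equation is a pathwise integral equation, so no stochastic calculus is
  involved: substitute \<open>\<epsilon> s\<close> for the time variable and apply the diagonal map that rescales the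
  coordinates.  That map turns the noise into the rescaled Brownian motion with the same
  coefficients because each coordinate with noise has exponent \<open>1 / 2\<close>.
\<close>

lemma solves_sde_rescale:
  fixes B x :: "real \<Rightarrow> 'a \<Rightarrow> real ^ 'n::finite"
  assumes sde: "solves_sde M F B f (diag_matrix \<sigma>) 0 x T" and \<epsilon>: "\<epsilon> > 0"
    and noise: "\<And>i. \<sigma> $ i \<noteq> 0 \<Longrightarrow> b i = 1 / 2"
    and drift: "\<And>z. g (\<chi> i. z $ i / \<epsilon> powr b i) = (\<chi> i. \<epsilon> * f z $ i / \<epsilon> powr b i)"
  shows "solves_sde M (\<lambda>t. F (\<epsilon> * t)) (\<lambda>t \<omega>. B (\<epsilon> * t) \<omega> /\<^sub>R sqrt \<epsilon>) g (diag_matrix \<sigma>) 0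
    (\<lambda>t \<omega>. \<chi> i. x (\<epsilon> * t) \<omega> $ i / \<epsilon> powr b i) (\<lambda>\<omega>. T \<omega> / ereal \<epsilon>)"
proof -
  define D :: "real ^ 'n \<Rightarrow> real ^ 'n" where "D z = (\<chi> i. z $ i / \<epsilon> powr b i)" for z
  have linD: "linear D"
    by (rule linearI) (simp_all add: D_def vec_eq_iff add_divide_distrib)
  then have D: "bounded_linear D" by (simp add: linear_conv_bounded_linear)
  have contD: "continuous_on UNIV D"
    using D by (rule linear_continuous_on)
  have meas: "{\<omega> \<in> space M. ereal t < T \<omega> / ereal \<epsilon>} \<in> sets (F (\<epsilon> * t)) \<and>
      (\<lambda>\<omega>. if ereal t < T \<omega> / ereal \<epsilon> then D (x (\<epsilon> * t) \<omega>) else 0) \<in> borel_measurable (F (\<epsilon> * t))"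
    if "t \<ge> 0" for t
  proof -
    have "0 \<le> \<epsilon> * t" using that \<epsilon> by simp
    then have 1: "{\<omega> \<in> space M. ereal (\<epsilon> * t) < T \<omega>} \<in> sets (F (\<epsilon> * t))"
      and 2: "(\<lambda>\<omega>. if ereal (\<epsilon> * t) < T \<omega> then x (\<epsilon> * t) \<omega> else 0) \<in> borel_measurable (F (\<epsilon> * t))"
      using sde unfolding solves_sde_def by blast+
    have "(\<lambda>\<omega>. D (if ereal (\<epsilon> * t) < T \<omega> then x (\<epsilon> * t) \<omega> else 0)) \<in> borel_measurable (F (\<epsilon> * t))"
      using 2 borel_measurable_continuous_onI[OF contD] by (rule measurable_compose)
    moreover have "(\<lambda>\<omega>. D (if ereal (\<epsilon> * t) < T \<omega> then x (\<epsilon> * t) \<omega> else 0)) =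
      (\<lambda>\<omega>. if ereal (\<epsilon> * t) < T \<omega> then D (x (\<epsilon> * t) \<omega>) else 0)"
      by (auto simp: linear_0[OF linD])
    ultimately show ?thesis
      using 1 by (simp add: ereal_less_divide_pos_iff[OF \<epsilon>])
  qed
  have "AE \<omega> in M. x 0 \<omega> = 0 \<and>
        continuous_on {t. 0 \<le> t \<and> ereal t < T \<omega>} (\<lambda>t. x t \<omega>) \<and>
        (\<forall>t. 0 \<le> t \<and> ereal t < T \<omega> \<longrightarrow>
           ((\<lambda>s. f (x s \<omega>)) has_integral (x t \<omega> - x 0 \<omega> - diag_matrix \<sigma> *v (B t \<omega> - B 0 \<omega>))) {0..t})"
    using sde by (simp add: solves_sde_def)
  then have paths: "AE \<omega> in M. D (x (\<epsilon> * 0) \<omega>) = 0 \<and>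
        continuous_on {t. 0 \<le> t \<and> ereal t < T \<omega> / ereal \<epsilon>} (\<lambda>t. D (x (\<epsilon> * t) \<omega>)) \<and>
        (\<forall>t. 0 \<le> t \<and> ereal t < T \<omega> / ereal \<epsilon> \<longrightarrow>
           ((\<lambda>s. g (D (x (\<epsilon> * s) \<omega>))) has_integral (D (x (\<epsilon> * t) \<omega>) - D (x (\<epsilon> * 0) \<omega>) -
              diag_matrix \<sigma> *v (B (\<epsilon> * t) \<omega> /\<^sub>R sqrt \<epsilon> - B (\<epsilon> * 0) \<omega> /\<^sub>R sqrt \<epsilon>))) {0..t})"
  proof eventually_elim
    case (elim \<omega>)
    have "continuous_on {t. 0 \<le> t \<and> ereal t < T \<omega> / ereal \<epsilon>} (\<lambda>t. x (\<epsilon> * t) \<omega>)"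
      using elim \<epsilon>
      by (intro continuous_on_compose2[of "{t. 0 \<le> t \<and> ereal t < T \<omega>}" "\<lambda>t. x t \<omega>" _ "(*) \<epsilon>"] continuous_intros)
         (auto simp: ereal_less_divide_pos_iff)
    then have "continuous_on {t. 0 \<le> t \<and> ereal t < T \<omega> / ereal \<epsilon>} (\<lambda>t. D (x (\<epsilon> * t) \<omega>))"
      by (rule continuous_on_compose2[OF contD]) auto
    moreover have "((\<lambda>s. g (D (x (\<epsilon> * s) \<omega>))) has_integral (D (x (\<epsilon> * t) \<omega>) - D (x (\<epsilon> * 0) \<omega>) -
              diag_matrix \<sigma> *v (B (\<epsilon> * t) \<omega> /\<^sub>R sqrt \<epsilon> - B (\<epsilon> * 0) \<omega> /\<^sub>R sqrt \<epsilon>))) {0..t}"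
      if t: "0 \<le> t" "ereal t < T \<omega> / ereal \<epsilon>" for t
    proof -
      define W where "W = B (\<epsilon> * t) \<omega> - B 0 \<omega>"
      have "((\<lambda>s. f (x s \<omega>)) has_integral (x (\<epsilon> * t) \<omega> - x 0 \<omega> - diag_matrix \<sigma> *v W)) {0..\<epsilon> * t}"
        using elim t \<epsilon> by (auto simp: ereal_less_divide_pos_iff W_def)
      from has_integral_time_scale[OF this \<epsilon>]
      have "((\<lambda>s. f (x (\<epsilon> * s) \<omega>)) has_integral
          ((x (\<epsilon> * t) \<omega> - x 0 \<omega> - diag_matrix \<sigma> *v W) /\<^sub>R \<epsilon>)) {0..t}" .
      then have "((\<lambda>s. \<epsilon> *\<^sub>R f (x (\<epsilon> * s) \<omega>)) has_integral
          (x (\<epsilon> * t) \<omega> - x 0 \<omega> - diag_matrix \<sigma> *v W)) {0..t}"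
        using \<epsilon> by (auto dest: has_integral_cmul[where c = \<epsilon>])
      from has_integral_linear[OF this D]
      have *: "((\<lambda>s. D (\<epsilon> *\<^sub>R f (x (\<epsilon> * s) \<omega>))) has_integral
          (D (x (\<epsilon> * t) \<omega>) - D (x 0 \<omega>) - D (diag_matrix \<sigma> *v W))) {0..t}"
        by (simp add: o_def linear_diff[OF linD])
      have "D (\<epsilon> *\<^sub>R f z) = g (D z)" for z
        unfolding D_def drift by simp
      moreover have "D (diag_matrix \<sigma> *v W) = diag_matrix \<sigma> *v (W /\<^sub>R sqrt \<epsilon>)"
      proof (rule vec_eq_iff[THEN iffD2, rule_format])
        fix i
        have "(diag_matrix \<sigma> *v v) $ i = \<sigma> $ i * v $ i" for v
          by (simp add: diag_matrix_def matrix_vector_mult_def if_distrib[of "\<lambda>a. a * _"] cong: if_cong)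
        note diag = this
        show "D (diag_matrix \<sigma> *v W) $ i = (diag_matrix \<sigma> *v (W /\<^sub>R sqrt \<epsilon>)) $ i"
        proof (cases "\<sigma> $ i = 0")
          case False
          then have "\<epsilon> powr b i = sqrt \<epsilon>"
            using noise[of i] powr_half_sqrt[of \<epsilon>] \<epsilon> by (metis less_imp_le)
          then show ?thesis by (simp add: diag D_def divide_inverse)
        qed (simp add: diag D_def)
      qed
      ultimately show ?thesis
        using * by (simp add: W_def scaleR_diff_right)
    qed
    ultimately show ?case using elim by (auto simp: linear_0[OF linD])
  qed
  have "filtered_prob_space M F" and bm: "brownian_motion M F B"
    using sde by (auto simp: solves_sde_def)
  moreover from this have "prob_space M" by (simp add: filtered_prob_space_def)
  ultimately show ?thesis
    using meas paths brownian_motion_rescale[OF _ bm \<epsilon>] filtered_prob_space_rescale[OF _ \<epsilon>]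
    unfolding solves_sde_def D_def by blast
qed


section \<open>The rescaled process\<close>

theorem theorem5p3:
  fixes P :: "'n::finite \<Rightarrow> 'n rpoly"
    and \<sigma> :: "real ^ 'n"
    and M :: "'a measure"
    and F :: "real \<Rightarrow> 'a measure"
    and B x :: "real \<Rightarrow> 'a \<Rightarrow> real ^ 'n"
    and \<tau> :: "'a \<Rightarrow> ereal"
  assumes "\<And>i. \<sigma> $ i \<ge> 0"
    and "solves_sde M F B (poly_field P) (diag_matrix \<sigma>) 0 x \<tau>"
    and "AE \<omega> in M. is_explosion_time (\<lambda>t. x t \<omega>) (\<tau> \<omega>)"
    and "noise_propagating P \<sigma>"
  shows "\<exists>R :: real \<Rightarrow> 'n \<Rightarrow> 'n rpoly.
    (\<forall>\<epsilon>>0.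
      solves_sde M (\<lambda>t. F (\<epsilon> * t)) (\<lambda>t \<omega>. B (\<epsilon> * t) \<omega> /\<^sub>R sqrt \<epsilon>)
        (\<lambda>y. poly_field (dominant P \<sigma>) y + poly_field (R \<epsilon>) y) (diag_matrix \<sigma>) 0
        (\<lambda>t \<omega>. \<chi> i. x (\<epsilon> * t) \<omega> $ i / \<epsilon> powr final_scal P \<sigma> i)
        (\<lambda>\<omega>. \<tau> \<omega> / ereal \<epsilon>)) \<and>
    (\<forall>C>0. ((\<lambda>\<epsilon>. SUP z\<in>cball 0 C. norm (poly_field (R \<epsilon>) z)) \<longlongrightarrow> 0) (at_right 0))"
proof (intro exI[of _ "scaled_remainder (final_scal P \<sigma>) P"] conjI allI impI)
  note np = \<open>noise_propagating P \<sigma>\<close>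
  show "((\<lambda>\<epsilon>. SUP z\<in>cball 0 C. norm (poly_field (scaled_remainder (final_scal P \<sigma>) P \<epsilon>) z)) \<longlongrightarrow> 0)
    (at_right 0)" if "C > 0" for C
    using scaled_remainder_tendsto_0[OF dominant_iff_drift_exponent_0(2)[OF np] that] .
  fix \<epsilon> :: real assume \<epsilon>: "\<epsilon> > 0"
  show "solves_sde M (\<lambda>t. F (\<epsilon> * t)) (\<lambda>t \<omega>. B (\<epsilon> * t) \<omega> /\<^sub>R sqrt \<epsilon>)
        (\<lambda>y. poly_field (dominant P \<sigma>) y + poly_field (scaled_remainder (final_scal P \<sigma>) P \<epsilon>) y)
        (diag_matrix \<sigma>) 0
        (\<lambda>t \<omega>. \<chi> i. x (\<epsilon> * t) \<omega> $ i / \<epsilon> powr final_scal P \<sigma> i) (\<lambda>\<omega>. \<tau> \<omega> / ereal \<epsilon>)"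
  proof (rule solves_sde_rescale[OF assms(2) \<epsilon>])
    show "final_scal P \<sigma> i = 1 / 2" if "\<sigma> $ i \<noteq> 0" for i
      using final_scal_noisy[OF np] that assms(1)[of i] by (simp add: order_less_le)
    show "poly_field (dominant P \<sigma>) (\<chi> i. z $ i / \<epsilon> powr final_scal P \<sigma> i) +
        poly_field (scaled_remainder (final_scal P \<sigma>) P \<epsilon>) (\<chi> i. z $ i / \<epsilon> powr final_scal P \<sigma> i) =
      (\<chi> i. \<epsilon> * poly_field P z $ i / \<epsilon> powr final_scal P \<sigma> i)" for z
      using rescaled_drift[OF np \<epsilon>, of _ z] by (simp add: vec_eq_iff poly_field_def)
  qed
qed

end
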